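(* Let $K$ be a field and let $f,g,h$ be nonconstant algebraically primitive multivariate Dirichlet polynomials over $K$ in the indeterminates $s_1,\dots,s_t$ ($t\ge2$) with $f=g\cdot h$. Fix $r\in\{1,\dots,t-1\}$. Then the upper Newton log-polygon of $f$ with respect to $s_r$ is obtained from translates of the edges of the upper Newton log-polygons of $g$ and $h$ with respect to $s_r$, using exactly one translate of each edge, arranged into a polygonal line with decreasing slopes from left to right. Equivalently, the set of slopes of edges of the upper Newton log-polygon of $f$ is the union of those for $g$ and $h$, and for each such slope the edge vector for $f$ is the sum of the edge vectors of that slope for $g$ and $h$ (an absent edge contributing zero).
   Context: Multivariate Dirichlet polynomials over $K$ are finite sums $\sum\frac{c_{i_1,\dots,i_t}}{i_1^{s_1}\cdots i_t^{s_t}}$ ($i_j$ positive integers, coefficients nonzero) with product $\frac{c}{j_1^{s_1}\cdots j_t^{s_t}}\cdot\frac{d}{k_1^{s_1}\cdots k_t^{s_t}}=\frac{cd}{(j_1k_1)^{s_1}\cdots (j_tk_t)^{s_t}}$ extended bilinearly; constant means supported on $\{(1,\dots,1)\}$; algebraically primitive means having no nonconstant factor consisting of a single term. The degree of a nonzero such polynomial with respect to $s_r$, $\deg_r$, is the maximum of $i_r$ over its support. Write $f=\sum_{i=n'}^{n}\frac{a_i}{i^{s_t}}$ with $a_i$ multivariate Dirichlet polynomials in $s_1,\dots,s_{t-1}$, $a_{n'}a_n\neq0$. The upper Newton log-polygon of $f$ with respect to $s_r$ is the upper convex hull of the points $(\log i,\log\deg_r a_i)$ for $a_i\ne0$: the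 polygonal line from $(\log n',\log\deg_r a_{n'})$ to $(\log n,\log\deg_r a_n)$ with no such point strictly above it, whose maximal straight pieces are its edges; an edge vector is the vector from the left endpoint to the right endpoint of an edge. *)

theory Defs
  imports "HOL-Analysis.Analysis" "HOL-Library.Poly_Mapping"
begin

(* The index tuple (i_1, ..., i_t) of the term c / (i_1^{s_1} ... i_t^{s_t}) is the function
   sending j in {1..t} to i_j and every other j to 1.  With this padding, polynomials in
   s_1, ..., s_{t-1} are literally polynomials in s_1, ..., s_t. *)

definition multi_indices :: "nat \<Rightarrow> (nat \<Rightarrow> nat) set" where
  "multi_indices t = {m. (\<forall>j\<in>{1..t}. 1 \<le> m j) \<and> (\<forall>j. j \<notin> {1..t} \<longrightarrow> m j = 1)}"

type_synonym 'k dirichlet = "(nat \<Rightarrow> nat) \<Rightarrow>\<^sub>0 'k"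

definition dirichlet_polys :: "nat \<Rightarrow> 'k::field dirichlet set" where
  "dirichlet_polys t = {f. Poly_Mapping.keys f \<subseteq> multi_indices t}"

(* Indices multiply, so this is not the product of the library's poly_mapping type (which adds
   keys). *)
definition dirichlet_mult :: "'k::field dirichlet \<Rightarrow> 'k dirichlet \<Rightarrow> 'k dirichlet"
    (infixl "\<star>" 70) where
  "f \<star> g = (\<Sum>a\<in>Poly_Mapping.keys f. \<Sum>b\<in>Poly_Mapping.keys g.
     Poly_Mapping.single (\<lambda>j. a j * b j) (Poly_Mapping.lookup f a * Poly_Mapping.lookup g b))"

definition is_constant :: "'k::field dirichlet \<Rightarrow> bool" where
  "is_constant f \<longleftrightarrow> Poly_Mapping.keys f \<subseteq> {\<lambda>_. 1}"

definition algebraically_primitive :: "nat \<Rightarrow> 'k::field dirichlet \<Rightarrow> bool" where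
  "algebraically_primitive t f \<longleftrightarrow>
     \<not> (\<exists>d\<in>dirichlet_polys t. \<exists>q\<in>dirichlet_polys t.
          card (Poly_Mapping.keys d) = 1 \<and> \<not> is_constant d \<and> f = d \<star> q)"

(* Meaningful for nonzero f only. *)
definition deg :: "nat \<Rightarrow> 'k::field dirichlet \<Rightarrow> nat" where
  "deg r f = Max ((\<lambda>m. m r) ` Poly_Mapping.keys f)"

(* The coefficient a_i of 1 / i^{s_t} in f, a polynomial in the indeterminates other than s_t. *)
definition slice :: "nat \<Rightarrow> 'k::field dirichlet \<Rightarrow> nat \<Rightarrow> 'k dirichlet" where
  "slice t f i = (\<Sum>m\<in>{m \<in> Poly_Mapping.keys f. m t = i}.
     Poly_Mapping.single (m(t := 1)) (Poly_Mapping.lookup f m))"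

definition newton_points :: "nat \<Rightarrow> nat \<Rightarrow> 'k::field dirichlet \<Rightarrow> (real \<times> real) set" where
  "newton_points t r f =
     {(ln (real i), ln (real (deg r (slice t f i)))) | i. slice t f i \<noteq> 0}"

definition upper_hull :: "(real \<times> real) set \<Rightarrow> (real \<times> real) set" where
  "upper_hull P = {p \<in> convex hull P. \<forall>y > snd p. (fst p, y) \<notin> convex hull P}"

definition newton_polygon :: "nat \<Rightarrow> nat \<Rightarrow> 'k::field dirichlet \<Rightarrow> (real \<times> real) set" where
  "newton_polygon t r f = upper_hull (newton_points t r f)"

(* An edge, i.e. a maximal nondegenerate segment of the line L, is recorded by its left and right
   endpoints.  A line consisting of a single point has no edge. *)
type_synonym edge = "(real \<times> real) \<times> (real \<times> real)"

definition edges :: "(real \<times> real) set \<Rightarrow> edge set" where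
  "edges L = {(a, b). fst a < fst b \<and> closed_segment a b \<subseteq> L \<and>
     (\<forall>c d. fst c < fst d \<and> closed_segment c d \<subseteq> L \<and> closed_segment a b \<subseteq> closed_segment c d
        \<longrightarrow> c = a \<and> d = b)}"

definition edge_vector :: "edge \<Rightarrow> real \<times> real" where
  "edge_vector e = snd e - fst e"

definition slope :: "edge \<Rightarrow> real" where
  "slope e = snd (edge_vector e) / fst (edge_vector e)"

(* v is the vector of an edge of slope \<sigma>, or zero if there is no such edge. *)
definition is_vector_of_slope :: "edge set \<Rightarrow> real \<Rightarrow> real \<times> real \<Rightarrow> bool" where
  "is_vector_of_slope E \<sigma> v \<longleftrightarrow>
     (\<exists>e\<in>E. slope e = \<sigma> \<and> v = edge_vector e) \<or> ((\<forall>e\<in>E. slope e \<noteq> \<sigma>) \<and> v = 0)"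

(* The polygonal line starting at p with the given successive step vectors. *)
fun polyline :: "real \<times> real \<Rightarrow> (real \<times> real) list \<Rightarrow> (real \<times> real) set" where
  "polyline p [] = {p}"
| "polyline p (v # vs) = closed_segment p (p + v) \<union> polyline (p + v) vs"

(* L is a polygonal line made of exactly one translate of each edge in E1 and of each edge in E2,
   by decreasing slopes.  The list enumerates the disjoint union of E1 and E2, so an edge common to
   both is used twice; an edge of E1 and one of E2 with equal slopes are placed consecutively,
   which is why the ordering is not strict. *)
definition assembled_from_edges ::
    "(real \<times> real) set \<Rightarrow> edge set \<Rightarrow> edge set \<Rightarrow> bool" where
  "assembled_from_edges L E1 E2 \<longleftrightarrow>
     (\<exists>xs p. distinct xs \<and> set xs = E1 <+> E2 \<and>
        sorted_wrt (\<lambda>x y. slope (case_sum id id x) \<ge> slope (case_sum id id y)) xs \<and>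
        L = polyline p (map (\<lambda>x. edge_vector (case_sum id id x)) xs))"

end

theory Submission
  imports Defs
begin

text \<open>The leading-term argument: for a linear functional \<open>w\<close>, the terms of \<open>g\<close> and of \<open>h\<close> on which
  \<open>w (log i\<^sub>t, log i\<^sub>r)\<close> is maximal contain a pair whose product cannot cancel, so the maxima of \<open>w\<close>
  add up under \<open>g \<star> h\<close>. If \<open>w\<close> does not decrease in the second coordinate, its maximum over all
  terms is its maximum over the Newton points, and these maxima determine the upper hull. The maximum
  of \<open>w\<close> on a polygonal line of decreasing slopes that starts at \<open>p\<close> with steps \<open>v\<close> is
  \<open>w p + \<Sum> max 0 (w v)\<close>; this depends only on the multiset of steps, and sums of such
  expressions correspond to merging the lists of steps.\<close>

section \<open>Support functions and upper hulls\<close>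

definition support :: "real \<times> real \<Rightarrow> (real \<times> real) set \<Rightarrow> real" where
  "support w P = Max ((\<bullet>) w ` P)"

lemma support_ge: "finite P \<Longrightarrow> z \<in> P \<Longrightarrow> w \<bullet> z \<le> support w P"
  by (simp add: support_def)

lemma support_attained:
  assumes "finite P" "P \<noteq> {}"
  obtains z where "z \<in> P" "w \<bullet> z = support w P"
  using Max_in[of "(\<bullet>) w ` P"] assms unfolding support_def by fastforce

lemma support_eqI:
  assumes "finite P" "\<And>z. z \<in> P \<Longrightarrow> w \<bullet> z \<le> s" "z \<in> P" "s \<le> w \<bullet> z"
  shows "support w P = s"
  unfolding support_def
proof (rule Max_eqI)
  show "s \<in> (\<bullet>) w ` P"
    using assms(2-4) by (metis antisym imageI)
qed (use assms in auto)

lemma inner_prod_real: "(w :: real \<times> real) \<bullet> z = fst w * fst z + snd w * snd z"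
  by (simp add: inner_prod_def)

text \<open>The region on or below the hull, written as a Minkowski sum with the vertical downward
  ray so that convexity and closedness follow from general facts on sums of sets.\<close>

definition hypo :: "(real \<times> real) set \<Rightarrow> (real \<times> real) set" where
  "hypo P = (\<Union>x \<in> convex hull P. \<Union>y \<in> {0} \<times> {..0}. {x + y})"

lemma hypo_iff: "z \<in> hypo P \<longleftrightarrow> (\<exists>q \<in> convex hull P. fst q = fst z \<and> snd z \<le> snd q)"
proof
  assume "z \<in> hypo P"
  then show "\<exists>q \<in> convex hull P. fst q = fst z \<and> snd z \<le> snd q"
    by (auto simp: hypo_def) force
next
  assume "\<exists>q \<in> convex hull P. fst q = fst z \<and> snd z \<le> snd q"
  then obtain q where q: "q \<in> convex hull P" "fst q = fst z" "snd z \<le> snd q" by blast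
  have "z = q + (0, snd z - snd q)"
    using q(2) by (simp add: prod_eq_iff)
  then show "z \<in> hypo P"
    unfolding hypo_def using q by (intro UN_I[of q] UN_I[of "(0, snd z - snd q)"]) auto
qed

lemma hull_subset_hypo: "convex hull P \<subseteq> hypo P"
  using hypo_iff by blast

lemma convex_hypo: "convex (hypo P)"
  unfolding hypo_def by (intro convex_sums convex_convex_hull convex_Times) auto

lemma closed_hypo:
  assumes "finite P"
  shows "closed (hypo P)"
proof -
  have "compact (convex hull P)"
    using assms by (simp add: finite_imp_compact_convex_hull)
  moreover have "closed ({0::real} \<times> {..0::real})"
    by (intro closed_Times) auto
  ultimately show ?thesis
    unfolding hypo_def by (rule compact_closed_sums)
qed

text \<open>A closed convex set is the intersection of the half-planes containing it. Functionals
  with negative second coordinate are unbounded on the downward ray, so only those with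
  \<open>0 \<le> snd w\<close> cut out the region.\<close>

lemma hypo_iff_support:
  assumes "finite P" "P \<noteq> {}"
  shows "z \<in> hypo P \<longleftrightarrow> (\<forall>w. 0 \<le> snd w \<longrightarrow> w \<bullet> z \<le> support w P)"
proof
  assume "z \<in> hypo P"
  then obtain q where q: "q \<in> convex hull P" "fst q = fst z" "snd z \<le> snd q"
    by (auto simp: hypo_iff)
  show "\<forall>w. 0 \<le> snd w \<longrightarrow> w \<bullet> z \<le> support w P"
  proof (intro allI impI)
    fix w :: "real \<times> real" assume w: "0 \<le> snd w"
    have "convex hull P \<subseteq> {x. w \<bullet> x \<le> support w P}"
      by (intro hull_minimal convex_halfspace_le) (auto intro: support_ge assms)
    then have "w \<bullet> q \<le> support w P"
      using q(1) by blast
    moreover have "w \<bullet> z \<le> w \<bullet> q"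
      using q w by (simp add: inner_prod_real mult_left_mono)
    ultimately show "w \<bullet> z \<le> support w P" by simp
  qed
next
  assume *: "\<forall>w. 0 \<le> snd w \<longrightarrow> w \<bullet> z \<le> support w P"
  show "z \<in> hypo P"
  proof (rule ccontr)
    assume "z \<notin> hypo P"
    then obtain a b where ab: "a \<bullet> z < b" "\<And>x. x \<in> hypo P \<Longrightarrow> b < a \<bullet> x"
      using separating_hyperplane_closed_point[OF convex_hypo closed_hypo[OF assms(1)]] by blast
    obtain p where p: "p \<in> P" using assms(2) by blast
    have down: "p - (0, c) \<in> hypo P" if "0 \<le> c" for c
      using p that by (auto simp: hypo_iff intro!: bexI[of _ p] hull_inc)
    have "snd a \<le> 0"
    proof (rule ccontr)
      assume "\<not> snd a \<le> 0"
      then have pos: "0 < snd a" by simp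
      \<comment> \<open>Descending by \<open>c\<close> from \<open>p\<close> brings the value of
        \<open>a\<close> down to at most \<open>b\<close>, although the point reached is still in
        \<open>hypo P\<close>.\<close>
      define c where "c = \<bar>a \<bullet> p - b\<bar> / snd a"
      have "b < a \<bullet> (p - (0, c))"
        using pos by (intro ab(2) down) (simp add: c_def)
      also have "a \<bullet> (p - (0, c)) = a \<bullet> p - \<bar>a \<bullet> p - b\<bar>"
        using pos by (simp add: inner_diff_right inner_prod_real[of a "(0, _)"] c_def)
      finally show False by linarith
    qed
    then have "(-a) \<bullet> z \<le> support (-a) P"
      using *[rule_format, of "- a"] by simp
    moreover obtain x where "x \<in> P" "(-a) \<bullet> x = support (-a) P"
      using support_attained assms by blast
    moreover have "b < a \<bullet> x"
      using \<open>x \<in> P\<close> by (intro ab(2)) (auto simp: hypo_iff intro!: bexI[of _ x] hull_inc)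
    ultimately show False
      using ab(1) by simp
  qed
qed

text \<open>Every point added below the hull has a hull point strictly above it, so the upper hull
  can be read off \<open>hypo P\<close>, the set that support functions control.\<close>

lemma upper_hull_hypo: "upper_hull P = {z \<in> hypo P. \<forall>y > snd z. (fst z, y) \<notin> hypo P}"
proof (intro equalityI subsetI)
  fix z assume "z \<in> upper_hull P"
  then have z: "z \<in> convex hull P" "\<And>y. snd z < y \<Longrightarrow> (fst z, y) \<notin> convex hull P"
    by (auto simp: upper_hull_def)
  have "(fst z, y) \<notin> hypo P" if "snd z < y" for y
  proof
    assume "(fst z, y) \<in> hypo P"
    then obtain q where "q \<in> convex hull P" "fst q = fst z" "y \<le> snd q"
      by (auto simp: hypo_iff)
    with z(2)[of "snd q"] that show False by (metis order_less_le_trans prod.collapse)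
  qed
  with z(1) show "z \<in> {z \<in> hypo P. \<forall>y > snd z. (fst z, y) \<notin> hypo P}"
    by (auto simp: hypo_iff)
next
  fix z assume z: "z \<in> {z \<in> hypo P. \<forall>y > snd z. (fst z, y) \<notin> hypo P}"
  then obtain q where q: "q \<in> convex hull P" "fst q = fst z" "snd z \<le> snd q"
    by (auto simp: hypo_iff)
  note sub = hull_subset_hypo[of P]
  with z q have "\<not> snd z < snd q"
    by (metis (mono_tags, lifting) mem_Collect_eq prod.collapse subsetD)
  with q have "z = q" by (simp add: prod_eq_iff)
  with q sub z show "z \<in> upper_hull P"
    by (auto simp: upper_hull_def)
qed

lemma upper_hull_cong_support:
  assumes "finite P" "P \<noteq> {}" "finite Q" "Q \<noteq> {}"
    and "\<And>w. 0 \<le> snd w \<Longrightarrow> support w P = support w Q"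
  shows "upper_hull P = upper_hull Q"
proof -
  have "z \<in> hypo P \<longleftrightarrow> z \<in> hypo Q" for z
    unfolding hypo_iff_support[OF assms(1,2)] hypo_iff_support[OF assms(3,4)]
    using assms(5) by metis
  then have "hypo P = hypo Q" by blast
  then show ?thesis by (simp add: upper_hull_hypo)
qed

section \<open>Polygonal lines with decreasing slopes\<close>

definition vslope :: "real \<times> real \<Rightarrow> real" where
  "vslope v = snd v / fst v"

lemma slope_vslope: "slope e = vslope (edge_vector e)"
  by (simp add: slope_def vslope_def)

definition rightward :: "(real \<times> real) list \<Rightarrow> bool" where
  "rightward vs \<longleftrightarrow> (\<forall>v \<in> set vs. 0 < fst v)"

abbreviation concave_steps :: "(real \<times> real) list \<Rightarrow> bool" where
  "concave_steps vs \<equiv> rightward vs \<and> sorted_wrt (\<lambda>u v. vslope u \<ge> vslope v) vs"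

abbreviation strict_steps :: "(real \<times> real) list \<Rightarrow> bool" where
  "strict_steps vs \<equiv> rightward vs \<and> sorted_wrt (\<lambda>u v. vslope u > vslope v) vs"

lemma rightward_simps [simp]:
  "rightward []" "rightward (v # vs) \<longleftrightarrow> 0 < fst v \<and> rightward vs"
  by (auto simp: rightward_def)

lemma strict_imp_concave: "strict_steps vs \<Longrightarrow> concave_steps vs"
  using sorted_wrt_mono_rel[of vs "\<lambda>u v. vslope u > vslope v" "\<lambda>u v. vslope u \<ge> vslope v"]
  by simp

text \<open>On rightward vectors the sign of a functional depends on the slope alone; the later sign
  arguments about steps rest on this.\<close>

lemma inner_vslope: "0 < fst v \<Longrightarrow> w \<bullet> v = fst v * (fst w + snd w * vslope v)"
  by (simp add: inner_prod_real vslope_def field_simps)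

lemma inner_normal: "0 < fst v \<Longrightarrow> (- s, 1) \<bullet> v = fst v * (vslope v - s)"
  by (simp add: inner_vslope)

text \<open>For \<open>0 \<le> snd w\<close> the value of \<open>w\<close> per unit of horizontal
  length does not decrease as the slope grows. Hence along decreasing slopes the steps with positive
  value form an initial segment.\<close>

lemma inner_nonpos_mono:
  assumes "0 < fst u" "0 < fst v" "vslope v \<le> vslope u" "0 \<le> snd w" "w \<bullet> u \<le> 0"
  shows "w \<bullet> v \<le> 0"
proof -
  have "fst w + snd w * vslope u \<le> 0"
    using assms(1,5) by (simp add: inner_vslope mult_le_0_iff)
  moreover have "snd w * vslope v \<le> snd w * vslope u"
    using assms(3,4) by (simp add: mult_left_mono)
  ultimately show ?thesis
    using assms(2) by (simp add: inner_vslope mult_le_0_iff)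
qed

fun vertices :: "real \<times> real \<Rightarrow> (real \<times> real) list \<Rightarrow> (real \<times> real) set" where
  "vertices p [] = {p}"
| "vertices p (v # vs) = insert p (vertices (p + v) vs)"

lemma finite_vertices [simp]: "finite (vertices p vs)"
  by (induction p vs rule: vertices.induct) auto

lemma start_in_vertices [simp]: "p \<in> vertices p vs"
  by (cases vs) auto

lemma vertices_nonempty [simp]: "vertices p vs \<noteq> {}"
  using start_in_vertices by blast

lemma start_in_polyline [simp]: "p \<in> polyline p vs"
  by (cases vs) auto

lemma polyline_subset_hull: "polyline p vs \<subseteq> convex hull vertices p vs"
proof (induction p vs rule: polyline.induct)
  case (2 p v vs)
  have "closed_segment p (p + v) \<subseteq> convex hull vertices p (v # vs)"
    by (intro closed_segment_subset_convex_hull hull_inc) auto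
  moreover have "convex hull vertices (p + v) vs \<subseteq> convex hull vertices p (v # vs)"
    by (intro hull_mono) auto
  ultimately show ?case using 2 by auto
qed auto

text \<open>The support function of the Minkowski sum of the segments from 0 to each step.\<close>

definition step_support :: "real \<times> real \<Rightarrow> (real \<times> real) list \<Rightarrow> real" where
  "step_support w vs = (\<Sum>v\<leftarrow>vs. max 0 (w \<bullet> v))"

lemma step_support_simps [simp]:
  "step_support w [] = 0" "step_support w (v # vs) = max 0 (w \<bullet> v) + step_support w vs"
  by (simp_all add: step_support_def)

lemma step_support_nonneg [simp]: "0 \<le> step_support w vs"
  by (induction vs) auto

lemma step_support_eq_0: "(\<And>v. v \<in> set vs \<Longrightarrow> w \<bullet> v \<le> 0) \<Longrightarrow> step_support w vs = 0"
  by (induction vs) auto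

lemma vertices_le: "z \<in> vertices p vs \<Longrightarrow> w \<bullet> z \<le> w \<bullet> p + step_support w vs"
proof (induction p vs rule: vertices.induct)
  case (2 p v vs)
  show ?case
  proof (cases "z = p")
    case True
    then show ?thesis using step_support_nonneg[of w vs] by simp
  next
    case False
    then have "w \<bullet> z \<le> w \<bullet> (p + v) + step_support w vs" using 2 by simp
    then show ?thesis by (simp add: inner_add_right)
  qed
qed auto

text \<open>Along decreasing slopes \<open>w\<close> first rises and never rises again once it has
  stopped, so the vertex where the rise ends has collected exactly the positive
  contributions.\<close>

lemma vertices_attain:
  "concave_steps vs \<Longrightarrow> 0 \<le> snd w \<Longrightarrow>
    \<exists>z \<in> vertices p vs. w \<bullet> z = w \<bullet> p + step_support w vs"
proof (induction p vs rule: vertices.induct)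
  case (2 p v vs)
  show ?case
  proof (cases "w \<bullet> v \<le> 0")
    case True
    have "step_support w vs = 0"
    proof (rule step_support_eq_0)
      fix u assume "u \<in> set vs"
      then have "0 < fst v" "0 < fst u" "vslope u \<le> vslope v"
        using 2(2) by (auto simp: rightward_def)
      then show "w \<bullet> u \<le> 0"
        using inner_nonpos_mono 2(3) True by blast
    qed
    then show ?thesis using True by auto
  next
    case False
    then show ?thesis using 2 by (auto simp: inner_add_right add.assoc)
  qed
qed auto

lemma support_vertices:
  assumes "concave_steps vs" "0 \<le> snd w"
  shows "support w (vertices p vs) = w \<bullet> p + step_support w vs"
proof -
  obtain z where "z \<in> vertices p vs" "w \<bullet> z = w \<bullet> p + step_support w vs"
    using vertices_attain[OF assms] by blast
  then show ?thesis
    by (intro support_eqI[of _ _ _ z]) (auto intro: vertices_le)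
qed

text \<open>The witness \<open>u\<close> is the step of a segment containing \<open>z\<close>: its
  normal vanishes on \<open>u\<close>, is nonnegative on earlier steps and nonpositive on later
  ones.\<close>

lemma polyline_supporting:
  "concave_steps vs \<Longrightarrow> z \<in> polyline p vs \<Longrightarrow> vs \<noteq> [] \<Longrightarrow>
    \<exists>u \<in> set vs. (- vslope u, 1) \<bullet> z = (- vslope u, 1) \<bullet> p + step_support (- vslope u, 1) vs"
proof (induction p vs rule: polyline.induct)
  case (2 p v vs)
  have v: "0 < fst v" using 2 by auto
  show ?case
  proof (cases "z \<in> closed_segment p (p + v)")
    case True
    then obtain s where s: "z = p + s *\<^sub>R v"
      by (auto simp: closed_segment_def algebra_simps)
    have "step_support (- vslope v, 1) vs = 0"
    proof (rule step_support_eq_0)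
      fix u assume "u \<in> set vs"
      then have "0 < fst u" "vslope u \<le> vslope v" using 2 by (auto simp: rightward_def)
      then show "(- vslope v, 1) \<bullet> u \<le> 0" by (simp add: inner_normal mult_le_0_iff)
    qed
    then show ?thesis
      using v by (auto simp: s inner_add_right inner_normal)
  next
    case False
    show ?thesis
    proof (cases "vs = []")
      case True
      with False 2(3) show ?thesis by simp
    next
      case ne: False
      then obtain u where u: "u \<in> set vs"
        "(- vslope u, 1) \<bullet> z = (- vslope u, 1) \<bullet> (p + v) + step_support (- vslope u, 1) vs"
        using 2 False by auto
      have "0 \<le> (- vslope u, 1) \<bullet> v"
        using v u(1) 2(2) by (auto simp: inner_normal)
      with u show ?thesis
        by (intro bexI[of _ u]) (auto simp: inner_add_right)
    qed
  qed
qed auto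

lemma polyline_covers:
  assumes "rightward vs" "q \<in> vertices p vs" "fst p \<le> x" "x \<le> fst q"
  shows "\<exists>z \<in> polyline p vs. fst z = x"
  using assms
proof (induction p vs rule: polyline.induct)
  case (2 p v vs)
  show ?case
  proof (cases "x \<le> fst p + fst v")
    case True
    define s where "s = (x - fst p) / fst v"
    have "0 \<le> s" "s \<le> 1" using 2 True by (auto simp: s_def field_simps)
    then have "p + s *\<^sub>R v \<in> closed_segment p (p + v)"
      by (auto simp: closed_segment_def algebra_simps intro!: exI[of _ s])
    moreover have "fst (p + s *\<^sub>R v) = x"
      using 2 by (simp add: s_def)
    ultimately show ?thesis by (intro bexI[of _ "p + s *\<^sub>R v"]) auto
  next
    case False
    then show ?thesis using 2 by auto
  qed
qed auto

text \<open>A point vertically above \<open>z\<close> would exceed the maximum of a functional with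
  second coordinate 1 that is already maximal at \<open>z\<close>.\<close>

lemma polyline_top:
  assumes "concave_steps vs" "z \<in> polyline p vs"
  shows "z \<in> upper_hull (vertices p vs)"
proof -
  have "(fst z, y) \<notin> convex hull vertices p vs" if y: "snd z < y" for y
  proof
    assume "(fst z, y) \<in> convex hull vertices p vs"
    then have h: "(fst z, y) \<in> hypo (vertices p vs)" by (rule subsetD[OF hull_subset_hypo])
    obtain w where w: "snd w = 1" "w \<bullet> z = w \<bullet> p + step_support w vs"
    proof (cases "vs = []")
      \<comment> \<open>Without steps the line is the single point \<open>p\<close>, and the
        vertical functional serves.\<close>
      case True
      with assms(2) show ?thesis by (intro that[of "(0, 1)"]) auto
    next
      case False
      with polyline_supporting[OF assms] show ?thesis by (metis snd_conv that)
    qed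
    then have "w \<bullet> (fst z, y) \<le> w \<bullet> z"
      using h[unfolded hypo_iff_support[OF finite_vertices vertices_nonempty], rule_format, of w]
      by (simp add: support_vertices assms)
    then show False using w y by (simp add: inner_prod_real)
  qed
  then show ?thesis
    using subsetD[OF polyline_subset_hull assms(2)] by (auto simp: upper_hull_def)
qed

text \<open>The functionals \<open>(1, 0)\<close> and \<open>(-1, 0)\<close> confine an upper hull
  point to the horizontal range of the line. The line has a point on the same vertical, and the
  upper hull has at most one point on each vertical.\<close>

lemma upper_hull_vertices:
  assumes "concave_steps vs"
  shows "upper_hull (vertices p vs) = polyline p vs"
proof (intro equalityI subsetI)
  fix z assume z: "z \<in> upper_hull (vertices p vs)"
  then have h: "z \<in> hypo (vertices p vs)" by (auto simp: upper_hull_hypo)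
  have right: "0 \<le> (1, 0) \<bullet> v" if "v \<in> set vs" for v
    using that assms by (auto simp: rightward_def inner_prod_real intro: less_imp_le)
  obtain q where q: "q \<in> vertices p vs" "(1, 0) \<bullet> q = support (1, 0) (vertices p vs)"
    by (rule support_attained[of "vertices p vs"]) auto
  have "(1, 0) \<bullet> z \<le> (1, 0) \<bullet> q"
    using h q by (simp add: hypo_iff_support)
  moreover have "step_support (-1, 0) vs = 0"
    using right by (intro step_support_eq_0) (auto simp: inner_prod_real)
  then have "(-1, 0) \<bullet> z \<le> (-1, 0) \<bullet> p"
    using h support_vertices[OF assms, of "(-1, 0)" p] by (simp add: hypo_iff_support del: split_paired_All) (metis snd_conv order_refl)
  ultimately have "fst p \<le> fst z" "fst z \<le> fst q"
    by (simp_all add: inner_prod_real)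
  then obtain z' where z': "z' \<in> polyline p vs" "fst z' = fst z"
    using polyline_covers q(1) assms by blast
  then have "z' \<in> upper_hull (vertices p vs)"
    using polyline_top assms by blast
  then have "\<not> snd z < snd z'" "\<not> snd z' < snd z"
    using z z'(2) unfolding upper_hull_def by (auto simp: mem_Collect_eq) (metis prod.collapse)+
  with z'(2) have "z = z'"
    by (simp add: prod_eq_iff)
  with z' show "z \<in> polyline p vs" by simp
qed (use polyline_top assms in blast)

text \<open>Reduces the identification of an upper hull to a comparison of support functions; it
  serves both for a single point set and for the sum of two.\<close>

lemma upper_hull_eq_polyline:
  assumes "finite P" "P \<noteq> {}" "concave_steps vs"
    and "\<And>w. 0 \<le> snd w \<Longrightarrow> support w P = w \<bullet> p + step_support w vs"
  shows "upper_hull P = polyline p vs"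
  using upper_hull_cong_support[of P "vertices p vs"] assms
  by (simp add: upper_hull_vertices support_vertices)

section \<open>Edges of polygonal lines\<close>

fun segs :: "real \<times> real \<Rightarrow> (real \<times> real) list \<Rightarrow> edge list" where
  "segs p [] = []"
| "segs p (v # vs) = (p, p + v) # segs (p + v) vs"

lemma map_edge_vector_segs [simp]: "map edge_vector (segs p vs) = vs"
  by (induction p vs rule: segs.induct) (auto simp: edge_vector_def)

lemma map_slope_segs: "map slope (segs p vs) = map vslope vs"
  by (induction p vs rule: segs.induct) (auto simp: slope_vslope edge_vector_def)

lemma set_segs_edge_vector: "e \<in> set (segs p vs) \<Longrightarrow> edge_vector e \<in> set vs"
  by (metis image_eqI list.set_map map_edge_vector_segs)

lemma segs_in_polyline: "e \<in> set (segs p vs) \<Longrightarrow> closed_segment (fst e) (snd e) \<subseteq> polyline p vs"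
  by (induction p vs rule: segs.induct) auto

lemma segs_rightward: "rightward vs \<Longrightarrow> e \<in> set (segs p vs) \<Longrightarrow> fst (fst e) < fst (snd e)"
  by (induction p vs rule: segs.induct) auto

lemma polyline_in_segs:
  "z \<in> polyline p vs \<Longrightarrow> vs \<noteq> [] \<Longrightarrow> \<exists>e \<in> set (segs p vs). z \<in> closed_segment (fst e) (snd e)"
proof (induction p vs rule: segs.induct)
  case (2 p v vs)
  then show ?case by (cases "vs = []") auto
qed auto

lemma inj_on_slope_segs:
  assumes "strict_steps vs"
  shows "inj_on slope (set (segs p vs))" "distinct (segs p vs)"
proof -
  have "sorted_wrt (\<lambda>x y. x > y) (map slope (segs p vs))"
    using assms by (simp add: map_slope_segs sorted_wrt_map)
  moreover have "sorted_wrt (\<lambda>x y. x > y) xs \<Longrightarrow> distinct xs" for xs :: "real list"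
    by (induction xs) auto
  ultimately have "distinct (map slope (segs p vs))" by blast
  then show "inj_on slope (set (segs p vs))" "distinct (segs p vs)"
    by (auto simp: distinct_map)
qed

lemma polyline_right_of_normal:
  assumes "\<And>u. u \<in> set vs \<Longrightarrow> w \<bullet> u < 0" "z \<in> polyline p vs"
  shows "w \<bullet> z \<le> w \<bullet> p \<and> (w \<bullet> z = w \<bullet> p \<longrightarrow> z = p)"
  using assms
proof (induction p vs rule: polyline.induct)
  case (2 p v vs)
  have v: "w \<bullet> v < 0" using 2 by auto
  show ?case
  proof (cases "z \<in> closed_segment p (p + v)")
    case True
    then obtain s where s: "z = p + s *\<^sub>R v" "0 \<le> s"
      by (auto simp: closed_segment_def algebra_simps)
    then show ?thesis using v
      by (auto simp: inner_add_right mult_le_0_iff)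
  next
    case False
    then have "w \<bullet> z \<le> w \<bullet> (p + v)" using 2 by auto
    then show ?thesis using v by (simp add: inner_add_right)
  qed
qed auto

text \<open>By strictly decreasing slopes the normal of \<open>e\<close> is positive on the steps
  before \<open>e\<close>, zero on \<open>e\<close> and negative on those after it. So its maximum
  over the line is attained exactly along \<open>e\<close>.\<close>

lemma seg_face:
  assumes "strict_steps vs" "e \<in> set (segs p vs)" "z \<in> polyline p vs" "w = (- slope e, 1)"
  shows "w \<bullet> z \<le> w \<bullet> fst e \<and> (w \<bullet> z = w \<bullet> fst e \<longrightarrow> z \<in> closed_segment (fst e) (snd e))"
  using assms
proof (induction p vs arbitrary: z rule: polyline.induct)
  case (2 p v vs)
  have v: "0 < fst v" and vs: "strict_steps vs" using 2 by auto
  show ?case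
  proof (cases "e = (p, p + v)")
    case True
    then have w: "w = (- vslope v, 1)" using 2 by (simp add: slope_vslope edge_vector_def)
    then have w0: "w \<bullet> v = 0" using v by (simp add: inner_normal)
    show ?thesis
    proof (cases "z \<in> closed_segment p (p + v)")
      case in_seg: True
      then obtain s where s: "z = p + s *\<^sub>R v"
        by (auto simp: closed_segment_def algebra_simps)
      then show ?thesis using True in_seg w0
        by (simp add: inner_add_right)
    next
      case False
      have "w \<bullet> u < 0" if "u \<in> set vs" for u
      proof -
        have "0 < fst u" "vslope u < vslope v" using 2(2) that by (auto simp: rightward_def)
        then show ?thesis by (simp add: w inner_normal mult_less_0_iff)
      qed
      then have "w \<bullet> z \<le> w \<bullet> (p + v) \<and> (w \<bullet> z = w \<bullet> (p + v) \<longrightarrow> z = p + v)"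
        using False 2(4) by (intro polyline_right_of_normal[of vs]) auto
      then show ?thesis using True w0 by (auto simp: inner_add_right)
    qed
  next
    case False
    then have e: "e \<in> set (segs (p + v) vs)" using 2 by simp
    have IH: "w \<bullet> x \<le> w \<bullet> fst e \<and> (w \<bullet> x = w \<bullet> fst e \<longrightarrow> x \<in> closed_segment (fst e) (snd e))"
      if "x \<in> polyline (p + v) vs" for x
      using 2(1)[OF vs e that 2(5)] .
    show ?thesis
    proof (cases "z \<in> polyline (p + v) vs")
      case True
      then show ?thesis by (rule IH)
    next
      case z: False
      then obtain s where s: "z = p + s *\<^sub>R v" "0 \<le> s" "s \<le> 1"
        using 2(4) by (auto simp: closed_segment_def algebra_simps)
      \<comment> \<open>The right endpoint of this segment already belongs to the tail, so
        \<open>z\<close> lies strictly before it.\<close>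
      have "s \<noteq> 1" using z s by auto
      then have "s < 1" using s by simp
      have "slope e < vslope v"
        using set_segs_edge_vector[OF e] 2(2) by (auto simp: slope_vslope)
      then have "0 < w \<bullet> v" using v by (simp add: 2 inner_normal)
      then have "w \<bullet> z < w \<bullet> (p + v)" using \<open>s < 1\<close> by (simp add: s inner_add_right)
      also have "\<dots> \<le> w \<bullet> fst e" using IH by simp
      finally show ?thesis by simp
    qed
  qed
qed auto

text \<open>The midpoint lies on some step \<open>e\<close>, where the normal of \<open>e\<close> is
  maximal. The mean of two values reaches the maximum only if both do, so \<open>seg_face\<close>
  puts both endpoints on \<open>e\<close>.\<close>

lemma segment_in_polyline:
  assumes "strict_steps vs" "closed_segment a b \<subseteq> polyline p vs" "fst a < fst b"
  shows "\<exists>e \<in> set (segs p vs). closed_segment a b \<subseteq> closed_segment (fst e) (snd e)"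
proof -
  have ab: "a \<in> polyline p vs" "b \<in> polyline p vs" "midpoint a b \<in> polyline p vs"
    using assms(2) by auto
  then have "vs \<noteq> []" using assms(3) by auto
  then obtain e where e: "e \<in> set (segs p vs)" "midpoint a b \<in> closed_segment (fst e) (snd e)"
    using polyline_in_segs ab by blast
  define w where "w = (- slope e, 1::real)"
  have pos: "0 < fst (edge_vector e)"
    using segs_rightward[of vs e p] assms(1) e by (simp add: edge_vector_def)
  obtain s where s: "midpoint a b = fst e + s *\<^sub>R edge_vector e"
    using e(2) by (auto simp: closed_segment_def edge_vector_def algebra_simps)
  have "w \<bullet> midpoint a b = w \<bullet> fst e"
    using pos unfolding s w_def slope_vslope by (simp add: inner_add_right inner_normal)
  moreover have "w \<bullet> midpoint a b = (w \<bullet> a + w \<bullet> b) / 2"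
    by (simp add: midpoint_def inner_add_right)
  moreover note seg_face[OF assms(1) e(1) ab(1) w_def] seg_face[OF assms(1) e(1) ab(2) w_def]
  ultimately have "a \<in> closed_segment (fst e) (snd e)" "b \<in> closed_segment (fst e) (snd e)"
    by auto
  then show ?thesis
    using e(1) by (meson closed_segment_subset convex_closed_segment)
qed

text \<open>Since all slopes differ, no segment contained in the line extends across a vertex, so
  each step is already maximal.\<close>

lemma edges_polyline:
  assumes "strict_steps vs"
  shows "edges (polyline p vs) = set (segs p vs)"
proof (intro equalityI subsetI)
  fix e assume "e \<in> edges (polyline p vs)"
  then have e: "fst (fst e) < fst (snd e)" "closed_segment (fst e) (snd e) \<subseteq> polyline p vs"
    "\<And>c d. fst c < fst d \<Longrightarrow> closed_segment c d \<subseteq> polyline p vs \<Longrightarrow>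
      closed_segment (fst e) (snd e) \<subseteq> closed_segment c d \<Longrightarrow> c = fst e \<and> d = snd e"
    by (auto simp: edges_def)
  obtain e' where e': "e' \<in> set (segs p vs)"
    "closed_segment (fst e) (snd e) \<subseteq> closed_segment (fst e') (snd e')"
    using segment_in_polyline[OF assms e(2,1)] by blast
  then have "e' = e"
    using e(3)[of "fst e'" "snd e'"] segs_in_polyline[OF e'(1)] segs_rightward[OF _ e'(1)] assms
    by (simp add: prod_eq_iff)
  with e' show "e \<in> set (segs p vs)" by simp
next
  fix e assume e: "e \<in> set (segs p vs)"
  have pos: "fst (fst x) < fst (snd x)" if "x \<in> set (segs p vs)" for x
    using segs_rightward that assms by blast
  have "c = fst e \<and> d = snd e"
    if cd: "fst c < fst d" "closed_segment c d \<subseteq> polyline p vs"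
      "closed_segment (fst e) (snd e) \<subseteq> closed_segment c d" for c d
  proof -
    obtain e' where e': "e' \<in> set (segs p vs)"
      "closed_segment c d \<subseteq> closed_segment (fst e') (snd e')"
      using segment_in_polyline[OF assms cd(2,1)] by blast
    \<comment> \<open>A segment containing \<open>e\<close> sits inside some \<open>e'\<close>, so
      \<open>e\<close> lies on the line through \<open>e'\<close>; then the slopes agree and
      strictness identifies the two.\<close>
    have on_line: "\<exists>s. x = fst e' + s *\<^sub>R edge_vector e'"
      if "x \<in> closed_segment (fst e) (snd e)" for x
    proof -
      have "x \<in> closed_segment (fst e') (snd e')" using that cd(3) e'(2) by blast
      then show ?thesis by (auto simp: closed_segment_def edge_vector_def algebra_simps)
    qed
    obtain s s' where ss: "fst e = fst e' + s *\<^sub>R edge_vector e'" "snd e = fst e' + s' *\<^sub>R edge_vector e'"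
      using on_line[of "fst e"] on_line[of "snd e"] by auto
    have ev: "edge_vector e = (s' - s) *\<^sub>R edge_vector e'"
      unfolding edge_vector_def[of e] ss by (simp add: scaleR_diff_left)
    have "s' - s \<noteq> 0"
      using ev pos[OF e] by (auto simp: edge_vector_def)
    then have "slope e = slope e'"
      by (simp add: slope_def ev)
    then have "e = e'"
      using inj_onD[OF inj_on_slope_segs(1)[OF assms] _ e e'(1)] by blast
    then have "closed_segment c d = closed_segment (fst e) (snd e)"
      using cd(3) e'(2) by auto
    then have "{c, d} = {fst e, snd e}"
      by (simp add: closed_segment_eq)
    then show ?thesis
      using cd(1) pos[OF e] by (auto simp: doubleton_eq_iff)
  qed
  then show "e \<in> edges (polyline p vs)"
    using segs_in_polyline[OF e] pos[OF e] by (auto simp: edges_def split_beta)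
qed

text \<open>The slope of a sum of rightward vectors is the mediant of their slopes and lies between
  them.\<close>

lemma vslope_add_less:
  "0 < fst u \<Longrightarrow> 0 < fst v \<Longrightarrow> vslope (v + u) < vslope v \<longleftrightarrow> vslope u < vslope v"
  by (simp add: vslope_def field_simps)

text \<open>Gift wrapping: the next vertex is the rightmost point among those seen from \<open>p\<close> under the
  greatest slope.\<close>

lemma upper_chain_exists:
  assumes "finite P" "p \<in> P" "\<And>z. z \<in> P \<Longrightarrow> fst p < fst z \<or> (fst z = fst p \<and> snd z \<le> snd p)"
  shows "\<exists>vs. strict_steps vs \<and> vertices p vs \<subseteq> P \<and>
    (\<forall>z \<in> P. \<forall>w. 0 \<le> snd w \<longrightarrow> w \<bullet> z \<le> w \<bullet> p + step_support w vs)"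
  using assms
proof (induction P arbitrary: p rule: finite_psubset_induct)
  case (psubset P)
  define R where "R = {z \<in> P. fst p < fst z}"
  show ?case
  proof (cases "R = {}")
    case True
    have "w \<bullet> z \<le> w \<bullet> p" if "z \<in> P" "0 \<le> snd w" for z w
    proof -
      have "fst z = fst p" "snd z \<le> snd p"
        using psubset(4)[OF that(1)] that(1) True by (auto simp: R_def simp del: split_paired_All)
      then show ?thesis using that(2) by (simp add: inner_prod_real mult_left_mono)
    qed
    then show ?thesis
      using psubset(3) by (intro exI[of _ "[]"]) auto
  next
    case False
    have finR: "finite R" using psubset(1) by (simp add: R_def)
    define M where "M = Max ((\<lambda>z. vslope (z - p)) ` R)"
    define T where "T = {z \<in> R. vslope (z - p) = M}"
    have "M \<in> (\<lambda>z. vslope (z - p)) ` R"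
      unfolding M_def using finR False by (intro Max_in) auto
    then have "T \<noteq> {}" by (auto simp: T_def)
    moreover have finT: "finite T" using finR by (simp add: T_def)
    ultimately obtain q where q: "q \<in> T" "Max (fst ` T) = fst q"
      using obtains_MAX by metis
    then have q_max: "fst z \<le> fst q" if "z \<in> T" for z
      using that finT by (metis Max_ge finite_imageI imageI)
    have le_M: "vslope (z - p) \<le> M" if "z \<in> R" for z
      using that finR by (simp add: M_def)
    define v where "v = q - p"
    have v: "0 < fst v" "vslope v = M" and qP: "q \<in> P" and pq: "fst p < fst q" and q_v: "q = p + v"
      using q(1) by (auto simp: T_def R_def v_def)
    \<comment> \<open>The induction continues with the points not left of \<open>q\<close>;
      \<open>p\<close> is gone, so the set has shrunk.\<close>
    define P' where "P' = {z \<in> P. fst q \<le> fst z}"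
    have "P' \<subseteq> P" "p \<notin> P'" using pq by (auto simp: P'_def)
    then have "P' \<subset> P" using psubset(3) by blast
    moreover have "q \<in> P'" using qP by (simp add: P'_def)
    \<comment> \<open>A higher point on the vertical through \<open>q\<close> would be seen from
      \<open>p\<close> under a slope exceeding \<open>M\<close>.\<close>
    moreover have "fst q < fst z \<or> (fst z = fst q \<and> snd z \<le> snd q)" if "z \<in> P'" for z
    proof (cases "fst q < fst z")
      case False
      then have z: "fst z = fst q" using that by (simp add: P'_def)
      then have "z \<in> R" using that pq by (simp add: P'_def R_def)
      then have "vslope (z - p) \<le> vslope (q - p)" using le_M v by (simp add: v_def)
      then have "snd z \<le> snd q" using z pq by (simp add: vslope_def divide_le_cancel)
      with z show ?thesis by simp
    qed simp
    ultimately obtain vs where vs: "strict_steps vs" "vertices q vs \<subseteq> P'"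
      "\<And>z w. z \<in> P' \<Longrightarrow> 0 \<le> snd w \<Longrightarrow> w \<bullet> z \<le> w \<bullet> q + step_support w vs"
      using psubset(2)[of P' q] by blast
    \<comment> \<open>As \<open>q\<close> is rightmost among the points seen under slope
      \<open>M\<close>, the next vertex is seen from \<open>p\<close> under a smaller slope, and the
      mediant comparison passes this on to the step \<open>u\<close>.\<close>
    have head: "vslope (hd vs) < vslope v" if ne: "vs \<noteq> []"
    proof -
      obtain u us where u: "vs = u # us" using ne by (cases vs) auto
      have "q + u \<in> P'" using vs(2) u by auto
      then have "q + u \<in> R" using pq vs(1) by (auto simp: R_def P'_def u)
      moreover have "q + u \<notin> T" using q_max[of "q + u"] vs(1) u by auto
      ultimately have "vslope (q + u - p) < M" using le_M[of "q + u"] by (auto simp: T_def)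
      then have "vslope (v + u) < vslope v" by (simp add: v(2) q_v add_ac)
      then show ?thesis using vslope_add_less[of u v] v vs(1) u by auto
    qed
    have "vslope u < vslope v" if "u \<in> set vs" for u
      using that head vs(1) by (cases vs) (auto dest: less_trans)
    then have "strict_steps (v # vs)" using v vs(1) by simp
    moreover have "vertices p (v # vs) \<subseteq> P"
      using vs(2) psubset(3) by (auto simp: q_v P'_def)
    moreover have "w \<bullet> z \<le> w \<bullet> p + step_support w (v # vs)" if "z \<in> P" "0 \<le> snd w" for z w
    proof (cases "z \<in> P'")
      case True
      then have "w \<bullet> z \<le> w \<bullet> q + step_support w vs" using vs(3) that by blast
      then show ?thesis by (simp add: q_v inner_add_right)
    next
      case False
      \<comment> \<open>\<open>s\<close> locates the point of the segment from \<open>p\<close> to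
        \<open>q\<close> on the vertical of \<open>z\<close>; \<open>z\<close> lies on or below
        it.\<close>
      define s where "s = (fst z - fst p) / fst v"
      have zp: "fst p \<le> fst z" "fst z < fst q" using psubset(4)[OF that(1)] False that by (auto simp: P'_def)
      then have s: "0 \<le> s" "s \<le> 1" using v(1) by (auto simp: s_def q_v)
      have "snd z \<le> snd p + s * snd v"
      proof (cases "z \<in> R")
        case True
        then have "vslope (z - p) \<le> vslope v" "0 < fst z - fst p" using le_M v by (auto simp: R_def)
        then show ?thesis using v(1) by (simp add: vslope_def s_def field_simps)
      next
        case False
        then show ?thesis using psubset(4)[OF that(1)] that(1) by (auto simp: R_def s_def)
      qed
      moreover have "fst z = fst p + s * fst v" using v(1) by (simp add: s_def)
      ultimately have "w \<bullet> z \<le> w \<bullet> (p + s *\<^sub>R v)"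
        using that(2) by (simp add: inner_prod_real mult_left_mono)
      also have "\<dots> \<le> w \<bullet> p + max 0 (w \<bullet> v)"
      proof -
        have "s * (w \<bullet> v) \<le> s * max 0 (w \<bullet> v)" using s by (intro mult_left_mono) auto
        also have "\<dots> \<le> max 0 (w \<bullet> v)" using s by (intro mult_left_le_one_le) auto
        finally show ?thesis by (simp add: inner_add_right)
      qed
      finally show ?thesis using step_support_nonneg[of w vs] by (simp del: step_support_nonneg)
    qed
    ultimately show ?thesis by blast
  qed
qed

text \<open>The chain starts at the highest point of the leftmost column. Its vertices belong to
  \<open>P\<close> and its support function bounds that of \<open>P\<close>, so the two agree for
  \<open>0 \<le> snd w\<close>.\<close>

lemma upper_hull_strict_polyline:
  assumes "finite P" "P \<noteq> {}"
  obtains p vs where "strict_steps vs" "upper_hull P = polyline p vs"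
    "\<And>w. 0 \<le> snd w \<Longrightarrow> support w P = w \<bullet> p + step_support w vs"
proof -
  define x where "x = Min (fst ` P)"
  define Q where "Q = {z \<in> P. fst z = x}"
  have "x \<in> fst ` P" unfolding x_def using assms by (intro Min_in) auto
  then have "Q \<noteq> {}" by (auto simp: Q_def)
  moreover have finQ: "finite Q" using assms by (simp add: Q_def)
  ultimately obtain p where p: "p \<in> Q" "Max (snd ` Q) = snd p"
    using obtains_MAX by metis
  then have "snd z \<le> snd p" if "z \<in> Q" for z
    using that finQ by (metis Max_ge finite_imageI imageI)
  moreover  have "x \<le> fst z" if "z \<in> P" for z using that assms by (simp add: x_def)
  ultimately have "fst p < fst z \<or> (fst z = fst p \<and> snd z \<le> snd p)" if "z \<in> P" for z
    using that p(1) unfolding Q_def by (metis (mono_tags, lifting) antisym_conv1 mem_Collect_eq)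
  moreover have "p \<in> P" using p by (simp add: Q_def)
  ultimately obtain vs where vs: "strict_steps vs" "vertices p vs \<subseteq> P"
    "\<And>z w. z \<in> P \<Longrightarrow> 0 \<le> snd w \<Longrightarrow> w \<bullet> z \<le> w \<bullet> p + step_support w vs"
    using upper_chain_exists[OF assms(1)] by metis
  have supp: "support w P = w \<bullet> p + step_support w vs" if w: "0 \<le> snd w" for w
  proof -
    obtain z where "z \<in> vertices p vs" "w \<bullet> z = w \<bullet> p + step_support w vs"
      using vertices_attain[OF strict_imp_concave[OF vs(1)] w] by blast
    then show ?thesis
      using vs(2,3) w assms(1) by (intro support_eqI[of _ _ _ z]) auto
  qed
  then show ?thesis
    using that vs(1) upper_hull_eq_polyline[OF assms strict_imp_concave[OF vs(1)]] by blast
qed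

section \<open>Minkowski sums\<close>

text \<open>An invariant under joining parallel steps; a slope without steps gives 0, matching the
  convention of \<open>is_vector_of_slope\<close> for absent edges.\<close>

definition slope_sum :: "real \<Rightarrow> (real \<times> real) list \<Rightarrow> real \<times> real" where
  "slope_sum \<sigma> vs = (\<Sum>v\<leftarrow>vs. if vslope v = \<sigma> then v else 0)"

lemma slope_sum_simps [simp]:
  "slope_sum \<sigma> [] = 0"
  "slope_sum \<sigma> (v # vs) = (if vslope v = \<sigma> then v else 0) + slope_sum \<sigma> vs"
  by (simp_all add: slope_sum_def)

lemma slope_sum_eq_0: "\<sigma> \<notin> vslope ` set vs \<Longrightarrow> slope_sum \<sigma> vs = 0"
  by (induction vs) auto

lemma fst_slope_sum_nonneg: "rightward vs \<Longrightarrow> 0 \<le> fst (slope_sum \<sigma> vs)"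
  by (induction vs) auto

lemma fst_slope_sum_pos: "rightward vs \<Longrightarrow> v \<in> set vs \<Longrightarrow> 0 < fst (slope_sum (vslope v) vs)"
proof (induction vs)
  case (Cons u vs)
  then have "0 < fst u" "0 \<le> fst (slope_sum (vslope v) vs)"
    by (auto intro: fst_slope_sum_nonneg)
  with Cons show ?case by auto
qed simp

text \<open>The first coordinates of the steps are positive and cannot cancel, so the total for a
  slope detects whether the slope occurs.\<close>

lemma slope_sum_nonzero_iff:
  assumes "rightward vs"
  shows "slope_sum \<sigma> vs \<noteq> 0 \<longleftrightarrow> \<sigma> \<in> vslope ` set vs"
proof
  assume "\<sigma> \<in> vslope ` set vs"
  then show "slope_sum \<sigma> vs \<noteq> 0"
    using fst_slope_sum_pos[OF assms] by (metis fst_zero image_iff less_irrefl)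
qed (use slope_sum_eq_0 in blast)

lemma slope_sum_strict: "strict_steps vs \<Longrightarrow> v \<in> set vs \<Longrightarrow> slope_sum (vslope v) vs = v"
proof (induction vs)
  case (Cons u vs)
  show ?case
  proof (cases "v = u")
    case True
    have "slope_sum (vslope u) vs = 0"
      using Cons(2) by (intro slope_sum_eq_0) auto
    then show ?thesis using True by simp
  next
    case False
    then show ?thesis using Cons by auto
  qed
qed simp

lemma sum_list_cong_mset:
  fixes f :: "'a \<Rightarrow> 'b::comm_monoid_add"
  shows "mset xs = mset ys \<Longrightarrow> sum_list (map f xs) = sum_list (map f ys)"
  by (metis mset_map sum_mset_sum_list)

lemma vslope_add_eq:
  "0 < fst u \<Longrightarrow> 0 < fst v \<Longrightarrow> vslope u = vslope v \<Longrightarrow> vslope (v + u) = vslope v"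
  by (simp add: vslope_def field_simps)

lemma closed_segment_merge:
  assumes "0 < fst u" "0 < fst v" "vslope u = vslope v"
  shows "closed_segment p (p + v) \<union> closed_segment (p + v) (p + v + u) = closed_segment p (p + v + u)"
proof (rule Un_closed_segment)
  \<comment> \<open>The fraction of the horizontal length of the joined segment that
    \<open>v\<close> covers.\<close>
  define s where "s = fst v / (fst v + fst u)"
  have "snd v * fst u = snd u * fst v"
    using assms by (simp add: vslope_def field_simps)
  then have "fst v * (snd v + snd u) = snd v * (fst v + fst u)"
    by (simp add: algebra_simps)
  then have "s * (snd v + snd u) = snd v" "s * (fst v + fst u) = fst v"
    using assms by (simp_all add: s_def)
  then have "v = s *\<^sub>R (v + u)"
    by (simp add: prod_eq_iff)
  then have "p + v = (1 - s) *\<^sub>R p + s *\<^sub>R (p + v + u)"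
    by (simp add: algebra_simps)
  moreover have "0 \<le> s" "s \<le> 1" using assms by (auto simp: s_def)
  ultimately show "p + v \<in> closed_segment p (p + v + u)"
    by (auto simp: closed_segment_def)
qed

text \<open>Edges are maximal segments, so parallel neighbours, which arise when two polygons share
  a slope, must be joined before \<open>edges_polyline\<close> applies.\<close>

lemma merge_equal_slopes:
  "concave_steps us \<Longrightarrow> \<exists>vs. strict_steps vs \<and> (\<forall>p. polyline p vs = polyline p us) \<and>
    (\<forall>\<sigma>. slope_sum \<sigma> vs = slope_sum \<sigma> us)"
proof (induction us)
  case Nil
  show ?case by (intro exI[of _ "[]"]) simp
next
  case (Cons v us)
  then obtain vs where vs: "strict_steps vs" "\<And>p. polyline p vs = polyline p us"
    "\<And>\<sigma>. slope_sum \<sigma> vs = slope_sum \<sigma> us" by auto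
  have v: "0 < fst v" using Cons by simp
  show ?case
  proof (cases vs)
    case Nil
    have "polyline p [v] = polyline p (v # us)" for p
      using vs(2)[of "p + v"] Nil by simp
    moreover have "slope_sum \<sigma> [v] = slope_sum \<sigma> (v # us)" for \<sigma>
      using vs(3)[of \<sigma>] Nil by simp
    ultimately show ?thesis using v by (intro exI[of _ "[v]"]) auto
  next
    case (Cons u ws)
    then have u: "0 < fst u" and ws: "\<And>x. x \<in> set ws \<Longrightarrow> vslope x < vslope u"
      using vs(1) by auto
    \<comment> \<open>The steps of \<open>vs\<close> need not be steps of \<open>us\<close>, but
      equal slope sums show that the slope of the head of \<open>vs\<close> occurs in
      \<open>us\<close>, which bounds it by that of \<open>v\<close>.\<close>
    have "vslope u \<in> vslope ` set us"
    proof -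
      have "slope_sum (vslope u) vs \<noteq> 0"
        using vs(1) Cons by (subst slope_sum_nonzero_iff) auto
      then show ?thesis
        using slope_sum_eq_0 vs(3) by metis
    qed
    then have "vslope u \<le> vslope v"
      using Cons.prems by auto
    then consider "vslope u < vslope v" | "vslope u = vslope v" by linarith
    then show ?thesis
    proof cases
      case 1
      then have "vslope x < vslope v" if "x \<in> set vs" for x
        using that Cons ws[of x] 1 by (cases "x = u") auto
      then have "strict_steps (v # vs)" using v vs(1) by simp
      with vs show ?thesis by (intro exI[of _ "v # vs"]) (simp del: split_paired_All)
    next
      case 2
      note add = vslope_add_eq[OF u v 2]
      have "strict_steps ((v + u) # ws)" using u v vs(1) Cons add 2 by auto
      moreover have "polyline p ((v + u) # ws) = polyline p (v # us)" for p
      proof -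
        have "polyline p (v # us) = closed_segment p (p + v) \<union>
            (closed_segment (p + v) (p + v + u) \<union> polyline (p + v + u) ws)"
          using vs(2)[of "p + v"] Cons by simp
        then show ?thesis
          using closed_segment_merge[OF u v 2, of p] by (simp add: Un_assoc[symmetric] add.assoc)
      qed
      moreover have "slope_sum \<sigma> ((v + u) # ws) = slope_sum \<sigma> (v # us)" for \<sigma>
        using vs(3)[of \<sigma>] Cons add 2 by auto
      ultimately show ?thesis by blast
    qed
  qed
qed

text \<open>With strict slopes at most one step has slope \<sigma>, so the sum is that step or the
  empty sum.\<close>

lemma is_vector_of_slope_segs:
  assumes "strict_steps vs"
  shows "is_vector_of_slope (set (segs p vs)) \<sigma> u \<longleftrightarrow> u = slope_sum \<sigma> vs"
proof -
  have vs: "set vs = edge_vector ` set (segs p vs)"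
    by (metis list.set_map map_edge_vector_segs)
  have sum: "slope_sum (slope e) vs = edge_vector e" if "e \<in> set (segs p vs)" for e
    using slope_sum_strict[OF assms] that vs by (simp add: slope_vslope)
  show ?thesis
  proof (cases "\<sigma> \<in> slope ` set (segs p vs)")
    case True
    then show ?thesis unfolding is_vector_of_slope_def by (metis image_iff sum)
  next
    case False
    then have "slope_sum \<sigma> vs = 0"
      by (intro slope_sum_eq_0) (auto simp: vs slope_vslope)
    then show ?thesis using False by (auto simp: is_vector_of_slope_def)
  qed
qed

lemma slope_image_segs:
  assumes "rightward vs"
  shows "slope ` set (segs p vs) = {\<sigma>. slope_sum \<sigma> vs \<noteq> 0}"
proof -
  have "slope ` set (segs p vs) = vslope ` set vs"
    by (metis list.set_map map_slope_segs)
  then show ?thesis using slope_sum_nonzero_iff[OF assms] by auto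
qed

text \<open>Sorting the concatenated steps keeps their multiset, so the line from
  \<open>p + q\<close> with the sorted steps has the sum of the two support functions and is
  therefore the upper hull of \<open>C\<close>.\<close>

lemma upper_hull_edges_of_support_sum:
  assumes "finite A" "A \<noteq> {}" "finite B" "B \<noteq> {}" "finite C" "C \<noteq> {}"
    and add: "\<And>w. 0 \<le> snd w \<Longrightarrow> support w C = support w A + support w B"
  defines "F \<equiv> edges (upper_hull C)"
    and "G \<equiv> edges (upper_hull A)"
    and "H \<equiv> edges (upper_hull B)"
  shows "assembled_from_edges (upper_hull C) G H"
    and "slope ` F = slope ` G \<union> slope ` H"
    and "is_vector_of_slope F \<sigma> u \<Longrightarrow> is_vector_of_slope G \<sigma> v \<Longrightarrow> is_vector_of_slope H \<sigma> w
      \<Longrightarrow> u = v + w"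
proof -
  obtain p vs where A: "strict_steps vs" "upper_hull A = polyline p vs"
    "\<And>w. 0 \<le> snd w \<Longrightarrow> support w A = w \<bullet> p + step_support w vs"
    using upper_hull_strict_polyline[OF assms(1,2)] by metis
  obtain q ws where B: "strict_steps ws" "upper_hull B = polyline q ws"
    "\<And>w. 0 \<le> snd w \<Longrightarrow> support w B = w \<bullet> q + step_support w ws"
    using upper_hull_strict_polyline[OF assms(3,4)] by metis
  have G: "G = set (segs p vs)" and H: "H = set (segs q ws)"
    by (simp_all add: G_def H_def A B edges_polyline)
  \<comment> \<open>The tags keep apart the two copies of an edge common to both polygons.\<close>
  define ys where "ys = map Inl (segs p vs) @ map Inr (segs q ws)"
  \<comment> \<open>Negating the key turns the ascending sort into one by decreasing slopes.\<close>
  define xs where "xs = sort_key (\<lambda>x. - slope (case_sum id id x)) ys"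
  define us where "us = map (\<lambda>x. edge_vector (case_sum id id x)) xs"
  have ys: "map (\<lambda>x. edge_vector (case_sum id id x)) ys = vs @ ws"
    by (simp add: ys_def comp_def)
  have mset_us: "mset us = mset (vs @ ws)"
    by (simp add: us_def xs_def flip: ys)
  have sorted: "sorted_wrt (\<lambda>x y. slope (case_sum id id x) \<ge> slope (case_sum id id y)) xs"
    using sorted_sort_key[of "\<lambda>x. - slope (case_sum id id x)" ys]
    by (simp add: sorted_wrt_map xs_def)
  have set_us: "set us = set vs \<union> set ws"
    using mset_eq_setD[OF mset_us] by simp
  then have "rightward us"
    using A(1) B(1) by (simp add: rightward_def ball_Un)
  then have us: "concave_steps us"
    using sorted by (simp add: us_def sorted_wrt_map slope_vslope)
  have C: "upper_hull C = polyline (p + q) us"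
  proof (rule upper_hull_eq_polyline[OF assms(5,6) us])
    fix w :: "real \<times> real" assume w: "0 \<le> snd w"
    have "step_support w us = step_support w vs + step_support w ws"
      using sum_list_cong_mset[OF mset_us] by (simp add: step_support_def)
    then show "support w C = w \<bullet> (p + q) + step_support w us"
      by (simp add: add A B w inner_add_right)
  qed
  have "distinct xs"
    using inj_on_slope_segs(2)[OF A(1), of p] inj_on_slope_segs(2)[OF B(1), of q]
    by (auto simp: xs_def ys_def distinct_map)
  moreover have "set xs = G <+> H"
    by (simp add: xs_def ys_def G H Plus_def)
  ultimately show "assembled_from_edges (upper_hull C) G H"
    unfolding assembled_from_edges_def C us_def using sorted by blast
  \<comment> \<open>Parallel steps coming from the two polygons are still separate in
    \<open>us\<close>; only after joining them are the segments edges.\<close>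
  obtain us' where us': "strict_steps us'" "\<And>p. polyline p us' = polyline p us"
    "\<And>\<sigma>. slope_sum \<sigma> us' = slope_sum \<sigma> us"
    using merge_equal_slopes[OF us] by blast
  have F: "F = set (segs (p + q) us')"
    using edges_polyline[OF us'(1), of "p + q"] us'(2) by (simp add: F_def C)
  have sum: "slope_sum \<sigma> us' = slope_sum \<sigma> vs + slope_sum \<sigma> ws" for \<sigma>
    using sum_list_cong_mset[OF mset_us] us'(3) by (simp add: slope_sum_def)
  have "slope ` F = vslope ` set us"
    using us us'(1) by (auto simp: F slope_image_segs us'(3) slope_sum_nonzero_iff)
  also have "\<dots> = slope ` G \<union> slope ` H"
    using A(1) B(1) by (auto simp: G H set_us slope_image_segs slope_sum_nonzero_iff)
  finally show "slope ` F = slope ` G \<union> slope ` H" .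
  show "u = v + w"
    if "is_vector_of_slope F \<sigma> u" "is_vector_of_slope G \<sigma> v" "is_vector_of_slope H \<sigma> w"
    using that A(1) B(1) us'(1) by (simp add: F G H is_vector_of_slope_segs sum)
qed

section \<open>Supports of products of Dirichlet polynomials\<close>

text \<open>Restricting both sets to the elements that maximize some coordinate preserves uniqueness,
  so the sets can be shrunk until they are singletons.\<close>

lemma unique_product_exists:
  fixes A B :: "('i \<Rightarrow> nat) set"
  assumes "finite A" "A \<noteq> {}" "finite B" "B \<noteq> {}"
    and "\<And>a j. a \<in> A \<Longrightarrow> 0 < a j" "\<And>b j. b \<in> B \<Longrightarrow> 0 < b j"
  shows "\<exists>a \<in> A. \<exists>b \<in> B. \<forall>a' \<in> A. \<forall>b' \<in> B.
    (\<lambda>j. a' j * b' j) = (\<lambda>j. a j * b j) \<longrightarrow> a' = a \<and> b' = b"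
  using assms
proof (induction "card A + card B" arbitrary: A B rule: less_induct)
  case less
  define top where "top S j = {x \<in> S. \<forall>y \<in> S. y j \<le> x j}" for S :: "('i \<Rightarrow> nat) set" and j
  have top_nonempty: "top S j \<noteq> {}" if S: "finite S" "S \<noteq> {}" for S j
  proof -
    obtain x where "x \<in> S" "Max ((\<lambda>x. x j) ` S) = x j"
      using obtains_MAX[OF S] .
    then have "x \<in> top S j"
      using S(1) by (auto simp: top_def) (metis Max_ge finite_imageI imageI)
    then show ?thesis by blast
  qed
  have top_subset: "top S j \<subseteq> S" for S j by (auto simp: top_def)
  show ?case
  proof (cases "\<exists>j. top A j \<noteq> A \<or> top B j \<noteq> B")
    case True
    then obtain j where j: "top A j \<noteq> A \<or> top B j \<noteq> B" by blast
    have "card (top A j) \<le> card A" "card (top B j) \<le> card B"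
      using less.prems(1,3) top_subset by (simp_all add: card_mono)
    moreover have "card (top A j) < card A \<or> card (top B j) < card B"
      using j less.prems top_subset by (metis psubsetI psubset_card_mono)
    ultimately have smaller: "card (top A j) + card (top B j) < card A + card B" by linarith
    have "finite (top A j)" "finite (top B j)"
      using less.prems top_subset finite_subset by metis+
    then have "\<exists>a \<in> top A j. \<exists>b \<in> top B j. \<forall>a' \<in> top A j. \<forall>b' \<in> top B j.
        (\<lambda>j. a' j * b' j) = (\<lambda>j. a j * b j) \<longrightarrow> a' = a \<and> b' = b"
      using less.prems top_subset top_nonempty by (intro less.hyps[OF smaller]) blast+
    then obtain a b where ab: "a \<in> top A j" "b \<in> top B j"
      "\<And>a' b'. a' \<in> top A j \<Longrightarrow> b' \<in> top B j \<Longrightarrow>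
        (\<lambda>j. a' j * b' j) = (\<lambda>j. a j * b j) \<Longrightarrow> a' = a \<and> b' = b" by metis
    \<comment> \<open>At coordinate \<open>j\<close> both factors are at most the maxima, so an
      equal positive product forces equality there and keeps the pair inside the smaller
      sets.\<close>
    have "a' = a \<and> b' = b"
      if *: "a' \<in> A" "b' \<in> B" "(\<lambda>j. a' j * b' j) = (\<lambda>j. a j * b j)" for a' b'
    proof -
      have le: "a' j \<le> a j" "b' j \<le> b j" using ab(1,2) * by (auto simp: top_def)
      have pos: "0 < a' j" "0 < b' j" using less.prems * by auto
      have eq: "a' j * b' j = a j * b j" using fun_cong[OF *(3)] .
      have "a' j = a j"
      proof (rule ccontr)
        assume "a' j \<noteq> a j"
        then have "a' j * b' j < a j * b j" using le pos by (intro mult_less_le_imp_less) auto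
        with eq show False by simp
      qed
      then have "b' j = b j" using eq pos by simp
      then have "a' \<in> top A j" "b' \<in> top B j"
        using \<open>a' j = a j\<close> ab(1,2) * by (auto simp: top_def)
      then show ?thesis using ab(3) * by blast
    qed
    then show ?thesis using ab(1,2) top_subset by blast
  next
    case False
    \<comment> \<open>Nothing shrinks, so the elements of each set agree in every coordinate and
      both sets are singletons.\<close>
    have "x = y" if "x \<in> S" "y \<in> S" "\<And>j. top S j = S" for S x y
    proof (intro ext antisym)
      fix j
      have "x \<in> top S j" "y \<in> top S j" using that by auto
      then show "x j \<le> y j" "y j \<le> x j" by (auto simp: top_def)
    qed
    then have single: "x = y" if "x \<in> S" "y \<in> S" "S = A \<or> S = B" for S x y
      using that False by blast
    obtain a b where "a \<in> A" "b \<in> B" using less.prems(2,4) by blast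
    then show ?thesis
      using single[of _ A] single[of _ B] by blast
  qed
qed

lemma lookup_dirichlet_mult:
  "Poly_Mapping.lookup (f \<star> g) m = (\<Sum>a\<in>Poly_Mapping.keys f. \<Sum>b\<in>Poly_Mapping.keys g.
     if (\<lambda>j. a j * b j) = m then Poly_Mapping.lookup f a * Poly_Mapping.lookup g b else 0)"
  by (simp add: dirichlet_mult_def lookup_sum lookup_single when_def)

lemma keys_dirichlet_mult:
  assumes "m \<in> Poly_Mapping.keys (f \<star> g)"
  obtains a b where "a \<in> Poly_Mapping.keys f" "b \<in> Poly_Mapping.keys g" "m = (\<lambda>j. a j * b j)"
proof -
  have "Poly_Mapping.lookup (f \<star> g) m \<noteq> 0"
    using assms by (simp add: in_keys_iff)
  then show ?thesis
    unfolding lookup_dirichlet_mult using that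
    by (auto elim!: sum.not_neutral_contains_not_neutral split: if_splits)
qed

text \<open>Only one pair of terms contributes to this coefficient, and a product of nonzero field
  elements is nonzero.\<close>

lemma unique_product_in_keys:
  assumes a: "a \<in> Poly_Mapping.keys f" and b: "b \<in> Poly_Mapping.keys g"
    and unique: "\<And>a' b'. a' \<in> Poly_Mapping.keys f \<Longrightarrow> b' \<in> Poly_Mapping.keys g \<Longrightarrow>
      (\<lambda>j. a' j * b' j) = (\<lambda>j. a j * b j) \<Longrightarrow> a' = a \<and> b' = b"
  shows "(\<lambda>j. a j * b j) \<in> Poly_Mapping.keys (f \<star> g)"
proof -
  have "Poly_Mapping.lookup (f \<star> g) (\<lambda>j. a j * b j) =
      (\<Sum>a'\<in>Poly_Mapping.keys f. \<Sum>b'\<in>Poly_Mapping.keys g.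
        if a' = a then if b' = b then Poly_Mapping.lookup f a * Poly_Mapping.lookup g b else 0 else 0)"
    unfolding lookup_dirichlet_mult using unique by (intro sum.cong refl) auto
  also have "\<dots> = (\<Sum>a'\<in>Poly_Mapping.keys f.
      if a' = a then Poly_Mapping.lookup f a * Poly_Mapping.lookup g b else 0)"
    using b by (intro sum.cong refl) simp
  also have "\<dots> = Poly_Mapping.lookup f a * Poly_Mapping.lookup g b"
    using a by simp
  finally show ?thesis
    using a b by (simp add: in_keys_iff)
qed

definition log_point :: "nat \<Rightarrow> nat \<Rightarrow> (nat \<Rightarrow> nat) \<Rightarrow> real \<times> real" where
  "log_point t r m = (ln (real (m t)), ln (real (m r)))"

lemma multi_indices_pos: "m \<in> multi_indices t \<Longrightarrow> 0 < m j"
  by (cases "j \<in> {1..t}") (force simp: multi_indices_def)+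

lemma log_point_mult:
  assumes "a \<in> multi_indices n" "b \<in> multi_indices n"
  shows "log_point t r (\<lambda>j. a j * b j) = log_point t r a + log_point t r b"
  using multi_indices_pos[OF assms(1)] multi_indices_pos[OF assms(2)]
  by (simp add: log_point_def ln_mult)

lemma support_log_points_mult:
  assumes g: "g \<in> dirichlet_polys n" "g \<noteq> 0" and h: "h \<in> dirichlet_polys n" "h \<noteq> 0"
  shows "support w (log_point t r ` Poly_Mapping.keys (g \<star> h)) =
    support w (log_point t r ` Poly_Mapping.keys g) + support w (log_point t r ` Poly_Mapping.keys h)"
proof -
  define L where "L = (\<lambda>m. w \<bullet> log_point t r m)"
  define sg where "sg = support w (log_point t r ` Poly_Mapping.keys g)"
  define sh where "sh = support w (log_point t r ` Poly_Mapping.keys h)"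
  have mi: "a \<in> multi_indices n" "b \<in> multi_indices n"
    if "a \<in> Poly_Mapping.keys g" "b \<in> Poly_Mapping.keys h" for a b
    using that g h by (auto simp: dirichlet_polys_def)
  have L_mult: "L (\<lambda>j. a j * b j) = L a + L b"
    if "a \<in> Poly_Mapping.keys g" "b \<in> Poly_Mapping.keys h" for a b
    unfolding L_def using mi[OF that] by (simp add: log_point_mult inner_add_right)
  have le: "L a \<le> sg" "L b \<le> sh"
    if "a \<in> Poly_Mapping.keys g" "b \<in> Poly_Mapping.keys h" for a b
    using that by (auto simp: L_def sg_def sh_def intro!: support_ge)
  define A where "A = {a \<in> Poly_Mapping.keys g. L a = sg}"
  define B where "B = {b \<in> Poly_Mapping.keys h. L b = sh}"
  have "A \<noteq> {}"
    using support_attained[of "log_point t r ` Poly_Mapping.keys g" w] g(2)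
    by (fastforce simp: A_def L_def sg_def)
  moreover have "B \<noteq> {}"
    using support_attained[of "log_point t r ` Poly_Mapping.keys h" w] h(2)
    by (fastforce simp: B_def L_def sh_def)
  moreover have "finite A" "finite B" by (simp_all add: A_def B_def)
  moreover have "\<And>a j. a \<in> A \<Longrightarrow> 0 < a j" "\<And>b j. b \<in> B \<Longrightarrow> 0 < b j"
    using g(1) h(1) by (auto simp: A_def B_def dirichlet_polys_def intro: multi_indices_pos)
  ultimately obtain a b where ab: "a \<in> A" "b \<in> B"
    "\<And>a' b'. a' \<in> A \<Longrightarrow> b' \<in> B \<Longrightarrow> (\<lambda>j. a' j * b' j) = (\<lambda>j. a j * b j) \<Longrightarrow> a' = a \<and> b' = b"
    using unique_product_exists[of A B] by metis
  then have ab_keys: "a \<in> Poly_Mapping.keys g" "b \<in> Poly_Mapping.keys h"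
    by (auto simp: A_def B_def)
  have L_ab: "L (\<lambda>j. a j * b j) = sg + sh"
    using ab(1,2) L_mult[OF ab_keys] by (simp add: A_def B_def)
  have "(\<lambda>j. a j * b j) \<in> Poly_Mapping.keys (g \<star> h)"
  proof (rule unique_product_in_keys[OF ab_keys])
    fix a' b' assume *: "a' \<in> Poly_Mapping.keys g" "b' \<in> Poly_Mapping.keys h"
      "(\<lambda>j. a' j * b' j) = (\<lambda>j. a j * b j)"
    \<comment> \<open>A competing pair also has total \<open>sg + sh\<close>, and neither summand
      exceeds its bound, so both terms are leading and uniqueness within \<open>A\<close> and
      \<open>B\<close> applies.\<close>
    then have "L a' + L b' = sg + sh"
      using L_mult[OF *(1,2)] L_ab by simp
    then have "L a' = sg" "L b' = sh" using le[OF *(1,2)] by auto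
    then show "a' = a \<and> b' = b"
      using ab(3) * by (simp add: A_def B_def)
  qed
  then show ?thesis
    unfolding sg_def[symmetric] sh_def[symmetric]
  proof (intro support_eqI)
    show "w \<bullet> z \<le> sg + sh" if z: "z \<in> log_point t r ` Poly_Mapping.keys (g \<star> h)" for z
    proof -
      obtain m where m: "m \<in> Poly_Mapping.keys (g \<star> h)" "z = log_point t r m" using z by blast
      obtain a' b' where *: "a' \<in> Poly_Mapping.keys g" "b' \<in> Poly_Mapping.keys h"
        "m = (\<lambda>j. a' j * b' j)" using keys_dirichlet_mult[OF m(1)] .
      then have "w \<bullet> z = L a' + L b'" using L_mult[OF *(1,2)] m(2) by (simp add: L_def)
      then show ?thesis using le[OF *(1,2)] by simp
    qed
  qed (use L_ab in \<open>auto simp: L_def\<close>)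
qed

section \<open>Slices and Newton points\<close>

lemma lookup_slice:
  "Poly_Mapping.lookup (slice t f i) n =
    (\<Sum>m\<in>{m \<in> Poly_Mapping.keys f. m t = i}. if m(t := 1) = n then Poly_Mapping.lookup f m else 0)"
  by (simp add: slice_def lookup_sum lookup_single when_def)

lemma keys_slice:
  "Poly_Mapping.keys (slice t f i) = (\<lambda>m. m(t := 1)) ` {m \<in> Poly_Mapping.keys f. m t = i}"
proof (intro equalityI subsetI)
  fix n assume "n \<in> Poly_Mapping.keys (slice t f i)"
  then have "Poly_Mapping.lookup (slice t f i) n \<noteq> 0"
    by (simp add: in_keys_iff)
  then show "n \<in> (\<lambda>m. m(t := 1)) ` {m \<in> Poly_Mapping.keys f. m t = i}"
    unfolding lookup_slice
    by (auto elim!: sum.not_neutral_contains_not_neutral split: if_splits)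
next
  fix n assume "n \<in> (\<lambda>m. m(t := 1)) ` {m \<in> Poly_Mapping.keys f. m t = i}"
  then obtain m where m: "m \<in> Poly_Mapping.keys f" "m t = i" "n = m(t := 1)" by blast
  \<comment> \<open>Within one slice the coordinate \<open>t\<close> is fixed, so resetting it to 1
    is injective and no terms collapse or cancel.\<close>
  have "m' = m" if "m' t = i" "m'(t := 1) = n" for m'
    using that m by (metis fun_upd_triv fun_upd_upd)
  then have "Poly_Mapping.lookup (slice t f i) n =
      (\<Sum>m'\<in>{m \<in> Poly_Mapping.keys f. m t = i}. if m' = m then Poly_Mapping.lookup f m else 0)"
    unfolding lookup_slice using m by (intro sum.cong refl) auto
  also have "\<dots> = Poly_Mapping.lookup f m" using m by simp
  finally show "n \<in> Poly_Mapping.keys (slice t f i)"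
    using m by (simp add: in_keys_iff)
qed

lemma deg_slice:
  assumes "r \<noteq> t"
  shows "deg r (slice t f i) = Max ((\<lambda>m. m r) ` {m \<in> Poly_Mapping.keys f. m t = i})"
  using assms by (simp add: deg_def keys_slice image_image)

lemma slice_nonzero_iff: "slice t f i \<noteq> 0 \<longleftrightarrow> (\<exists>m \<in> Poly_Mapping.keys f. m t = i)"
  using keys_slice[of t f i] by (simp flip: keys_eq_empty) blast

text \<open>The degree of a slice is attained by one of its terms, whose coordinate \<open>r\<close>
  survives the resetting of coordinate \<open>t\<close>.\<close>

lemma newton_points_subset:
  assumes "r \<noteq> t"
  shows "newton_points t r f \<subseteq> log_point t r ` Poly_Mapping.keys f"
proof
  fix z assume "z \<in> newton_points t r f"
  then obtain i where i: "z = (ln (real i), ln (real (deg r (slice t f i))))"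
    "{m \<in> Poly_Mapping.keys f. m t = i} \<noteq> {}"
    by (auto simp: newton_points_def slice_nonzero_iff)
  have "finite {m \<in> Poly_Mapping.keys f. m t = i}" by simp
  then obtain m where "m \<in> {m \<in> Poly_Mapping.keys f. m t = i}"
    "Max ((\<lambda>m. m r) ` {m \<in> Poly_Mapping.keys f. m t = i}) = m r"
    using i(2) by (rule obtains_MAX)
  then show "z \<in> log_point t r ` Poly_Mapping.keys f"
    using i(1) assms by (auto simp: deg_slice log_point_def)
qed

lemma newton_point_above:
  assumes "r \<noteq> t" "m \<in> Poly_Mapping.keys f" "0 < m r"
  shows "\<exists>z \<in> newton_points t r f. fst z = fst (log_point t r m) \<and> snd (log_point t r m) \<le> snd z"
proof -
  have "slice t f (m t) \<noteq> 0"
    using assms by (auto simp: slice_nonzero_iff)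
  moreover have "m r \<le> deg r (slice t f (m t))"
    unfolding deg_slice[OF assms(1)] using assms(2) by (intro Max_ge) auto
  then have "ln (real (m r)) \<le> ln (real (deg r (slice t f (m t))))"
    using assms(3) by simp
  ultimately show ?thesis
    by (auto simp: newton_points_def log_point_def)
qed

lemma newton_points_nonempty:
  assumes "f \<noteq> 0"
  shows "newton_points t r f \<noteq> {}"
proof -
  obtain m where "m \<in> Poly_Mapping.keys f"
    using assms by (metis all_not_in_conv keys_eq_empty)
  then show ?thesis by (auto simp: newton_points_def slice_nonzero_iff)
qed

lemma finite_newton_points: "r \<noteq> t \<Longrightarrow> finite (newton_points t r f)"
  by (rule finite_subset[OF newton_points_subset]) auto

text \<open>Newton points keep the highest log point on each vertical; a functional with
  \<open>0 \<le> snd w\<close> takes no larger value at the points below it.\<close>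

lemma support_newton_points:
  assumes "f \<in> dirichlet_polys n" "f \<noteq> 0" "r \<noteq> t" "0 \<le> snd w"
  shows "support w (newton_points t r f) = support w (log_point t r ` Poly_Mapping.keys f)"
proof -
  obtain z where z: "z \<in> log_point t r ` Poly_Mapping.keys f"
    "w \<bullet> z = support w (log_point t r ` Poly_Mapping.keys f)"
    using support_attained[of "log_point t r ` Poly_Mapping.keys f" w] assms(2) by auto
  then obtain m where m: "m \<in> Poly_Mapping.keys f" "z = log_point t r m" by blast
  then have "0 < m r" using assms(1) by (auto simp: dirichlet_polys_def intro: multi_indices_pos)
  then obtain z' where z': "z' \<in> newton_points t r f" "fst z' = fst z" "snd z \<le> snd z'"
    using newton_point_above[OF assms(3) m(1)] m(2) by blast
  have "w \<bullet> z \<le> w \<bullet> z'"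
    using z' assms(4) by (simp add: inner_prod_real mult_left_mono)
  moreover have "w \<bullet> x \<le> w \<bullet> z" if "x \<in> newton_points t r f" for x
    using that newton_points_subset[OF assms(3), of f] by (auto simp: z(2) intro!: support_ge)
  ultimately show ?thesis
    using z' finite_newton_points[OF assms(3)] by (intro support_eqI[of _ _ _ z']) (auto simp: z(2))
qed

lemma nonconstant_nonzero: "\<not> is_constant f \<Longrightarrow> f \<noteq> 0"
  by (auto simp: is_constant_def)

theorem theorem9p1:
  fixes f g h :: "'k::field dirichlet" and t r :: nat
  assumes "t \<ge> 2"
    and "r \<in> {1..t - 1}"
    and "f \<in> dirichlet_polys t" "\<not> is_constant f" "algebraically_primitive t f"
    and "g \<in> dirichlet_polys t" "\<not> is_constant g" "algebraically_primitive t g"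
    and "h \<in> dirichlet_polys t" "\<not> is_constant h" "algebraically_primitive t h"
    and "f = g \<star> h"
  defines "F \<equiv> edges (newton_polygon t r f)"
    and "G \<equiv> edges (newton_polygon t r g)"
    and "H \<equiv> edges (newton_polygon t r h)"
  shows "assembled_from_edges (newton_polygon t r f) G H \<and>
    slope ` F = slope ` G \<union> slope ` H \<and>
    (\<forall>\<sigma> \<in> slope ` F. \<forall>u v w.
       is_vector_of_slope F \<sigma> u \<and> is_vector_of_slope G \<sigma> v \<and> is_vector_of_slope H \<sigma> w
         \<longrightarrow> u = v + w)"
proof -
  have rt: "r \<noteq> t" using assms(1,2) by auto
  note nz = nonconstant_nonzero[OF assms(4)] nonconstant_nonzero[OF assms(7)]
    nonconstant_nonzero[OF assms(10)]
  \<comment> \<open>Additivity, known for the log points of all terms, is carried over to the Newton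
    points of each polynomial.\<close>
  have "support w (newton_points t r f) =
      support w (newton_points t r g) + support w (newton_points t r h)" if "0 \<le> snd w" for w
    using support_log_points_mult[OF assms(6) nz(2) assms(9) nz(3), of w t r]
    by (simp add: support_newton_points[OF assms(3) nz(1) rt that, unfolded assms(12)] assms(12)
        support_newton_points[OF assms(6) nz(2) rt that]
        support_newton_points[OF assms(9) nz(3) rt that])
  note sum = upper_hull_edges_of_support_sum[
      OF finite_newton_points[OF rt] newton_points_nonempty[OF nz(2)]
        finite_newton_points[OF rt] newton_points_nonempty[OF nz(3)]
        finite_newton_points[OF rt] newton_points_nonempty[OF nz(1)] this]
  show ?thesis
    unfolding F_def G_def H_def newton_polygon_def using sum by blast
qed

end
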